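(* Let $m\ge 1$ be a fixed integer. Let $\beta=\{b_j\}_{j=1}^\infty$ be a sequence of strictly positive real numbers with $b_j\to\infty$ as $j\to\infty$. Let $\delta=\{d_j\}_{j=1}^\infty$ be given by $d_j=\frac{1}{f(j)}$, where $f:(0,\infty)\to(0,\infty)$ is a $C^3$ function with $f(x)>0$ and $f'(x)>0$ for all $x>0$, satisfying, as $x\to\infty$, (i) $f(x)\to\infty$; (ii) $\frac{f'(x)}{f(x)}\to 0$; (iii) $\frac{f''(x)/f'(x)}{f'(x)/f(x)}=O(1)$; (iv) $\frac{f'''(x)\,f(x)^2}{f'(x)^3}=O(1)$. Let $\alpha=\{a_j\}_{j=1}^\infty$ be the interlacing of $\beta$ and $\delta$, i.e. $a_{2j-1}=b_j$ and $a_{2j}=d_j$ for $j=1,2,\dots$. For $M\ge 1$ put $N=2M$, $B_M=\sum_{j=1}^M b_j$ and $D_M=\sum_{j=1}^M d_j$. Then, as $N=2M\to\infty$, $$E\left[T_m(N;\alpha)\right]\sim (D_M+B_M)\int_0^\infty\left[1-\prod_{j=1}^M\Big(1-S_m(d_ju)\,e^{-d_ju}\Big)\right]du .$$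
   Context: Coupon collecting (double Dixie cup problem): given a sequence $\alpha=\{a_j\}_{j=1}^\infty$ of strictly positive numbers and a positive integer $N$, there are $N$ coupon types $1,\dots,N$, and a randomly chosen coupon is of type $j$ with probability $p_j=a_j/A_N$, where $A_N=\sum_{j=1}^N a_j$. Coupons are drawn independently, with replacement, each according to these probabilities. $T_m(N;\alpha)$ denotes the number of draws needed until every one of the $N$ types has been drawn at least $m$ times, and $E[T_m(N;\alpha)]$ is its expectation. $S_m(y)=\sum_{i=0}^{m-1}\frac{y^i}{i!}$ is the $m$-th partial sum of $e^y$. The notation $x_n\sim y_n$ as $n\to\infty$ means $\lim_{n\to\infty}x_n/y_n=1$. *)

theory Defs
  imports "HOL-Probability.Probability" "HOL-Library.Landau_Symbols"
begin

text \<open>Sequences are indexed from 1, as in the usual notation; their value at 0 is never used.\<close>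

definition coupon_pmf :: "nat \<Rightarrow> (nat \<Rightarrow> real) \<Rightarrow> nat pmf" where
  "coupon_pmf N a = embed_pmf (\<lambda>j. if j \<in> {1..N} then a j / (\<Sum>i=1..N. a i) else 0)"

text \<open>Independent draws: the product space of infinite sequences \<open>\<omega>\<close>, where \<open>\<omega> 0, \<omega> 1, \<dots>\<close> are the
  types of the first, second, \dots coupon drawn.\<close>

definition coupon_space :: "nat \<Rightarrow> (nat \<Rightarrow> real) \<Rightarrow> (nat \<Rightarrow> nat) measure" where
  "coupon_space N a = PiM (UNIV :: nat set) (\<lambda>_. measure_pmf (coupon_pmf N a))"

text \<open>The infimum of the empty set is \<open>\<infinity>\<close>, i.e. the collection is never completed.\<close>

definition collect_time :: "nat \<Rightarrow> nat \<Rightarrow> (nat \<Rightarrow> nat) \<Rightarrow> enat" where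
  "collect_time m N \<omega> = (INF n \<in> {n. \<forall>j\<in>{1..N}. m \<le> card {i. i < n \<and> \<omega> i = j}}. enat n)"

definition expected_collect_time :: "nat \<Rightarrow> nat \<Rightarrow> (nat \<Rightarrow> real) \<Rightarrow> ennreal" where
  "expected_collect_time m N a =
     (\<integral>\<^sup>+ \<omega>. ennreal_of_enat (collect_time m N \<omega>) \<partial>coupon_space N a)"

definition exp_partial_sum :: "nat \<Rightarrow> real \<Rightarrow> real" where
  "exp_partial_sum m y = (\<Sum>i<m. y ^ i / fact i)"

text \<open>\<open>x\<^sub>n \<sim> y\<^sub>n\<close> is read literally as \<open>x\<^sub>n / y\<^sub>n \<longrightarrow> 1\<close>. Unlike \<^const>\<open>asymp_equiv\<close>, this does not count
  \<open>0 / 0\<close> as 1, so it also excludes that either side is (eventually) a default value 0 standing for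
  an infinite expectation or a divergent integral.\<close>

definition seq_asymp :: "(nat \<Rightarrow> real) \<Rightarrow> (nat \<Rightarrow> real) \<Rightarrow> bool" where
  "seq_asymp x y \<longleftrightarrow> (\<lambda>n. x n / y n) \<longlonglongrightarrow> 1"

end

theory Submission
  imports Defs "HOL-Analysis.FPS_Convergence"
begin

text \<open>
  Let $q_n$ be the probability that $n$ draws complete the collection. Conditioning on the first draw
  gives a recurrence which identifies $q_n$ with the coefficient of $s^n / n!$ in
  $\prod_j (e^{p_j s} - S_m(p_j s))$. Since $\int_0^\infty e^{-s} s^n / n!\, ds = 1$, summing
  $P(T_m > n) = 1 - q_n$ under the integral sign yields
  $E[T_m] = A_N \int_0^\infty (1 - \prod_j (1 - S_m(a_j u) e^{-a_j u}))\, du$.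

  Write $J_\alpha$ for this integral, the mean of the maximum of independent variables $G_j / a_j$ with
  $G_j$ Gamma distributed. Then $J_\delta \le J_\alpha \le J_\delta + J_\beta$, so it suffices that
  $J_\beta = o(J_\delta)$. Let $K_n$ be the mean of the maximum of $n$ of the $G_j$. If $c > 0$ bounds the
  $b_j$ from below, then $J_\beta \le K_M / c$, while keeping only the indices $j > M/2$ gives
  $J_\delta \ge f(\lfloor M/2 \rfloor) K_{\lceil M/2 \rceil}$. As $K_M \le 2 K_{\lceil M/2 \rceil}$ by the
  union bound, $J_\beta / J_\delta \le 2 / (c f(\lfloor M/2 \rfloor)) \to 0$.
\<close>

unbundle fps_syntax

section \<open>Gamma distribution functions\<close>

text \<open>For \<open>y\<close> \<ge> 0 and \<open>m\<close> \<ge> 1 this is the probability that a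
  Poisson process of rate 1 has at least \<open>m\<close> points up to time \<open>y\<close>, hence
  the distribution function of a Gamma variable with shape \<open>m\<close> and rate 1.\<close>

definition gamma_cdf :: "nat \<Rightarrow> real \<Rightarrow> real" where
  "gamma_cdf m y = 1 - exp_partial_sum m y * exp (- y)"

lemma gamma_cdf_measurable [measurable]: "gamma_cdf m \<in> borel_measurable borel"
  unfolding gamma_cdf_def exp_partial_sum_def by measurable

text \<open>The derivative telescopes: each further term of the partial sum contributes the
  difference of two consecutive Erlang densities, so only the last density survives.\<close>

lemma gamma_cdf_has_derivative:
  "(gamma_cdf (Suc k) has_real_derivative y ^ k / fact k * exp (- y)) (at y)"
proof (induction k)
  case 0
  show ?case
    unfolding gamma_cdf_def exp_partial_sum_def by (auto intro!: derivative_eq_intros)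
next
  case (Suc k)
  have eq: "gamma_cdf (Suc (Suc k)) = (\<lambda>y. gamma_cdf (Suc k) y - y ^ Suc k / fact (Suc k) * exp (- y))"
    by (rule ext) (simp add: gamma_cdf_def exp_partial_sum_def algebra_simps)
  have fact: "y ^ k / fact k * exp (- y) = real (Suc k) * y ^ k / fact (Suc k) * exp (- y)"
    unfolding fact_Suc of_nat_mult by (simp del: of_nat_Suc)
  have "((\<lambda>y. y ^ Suc k / fact (Suc k) * exp (- y)) has_real_derivative
      y ^ k / fact k * exp (- y) - y ^ Suc k / fact (Suc k) * exp (- y)) (at y)"
    unfolding fact
    by (auto intro!: derivative_eq_intros simp: field_simps
        simp del: fact_Suc of_nat_Suc power_Suc)
  from DERIV_diff[OF Suc.IH this] show ?case
    unfolding eq by simp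
qed

lemma gamma_cdf_mono:
  assumes "0 \<le> x" "x \<le> y"
  shows "gamma_cdf m x \<le> gamma_cdf m y"
proof (cases m)
  case 0
  then show ?thesis by (simp add: gamma_cdf_def exp_partial_sum_def)
next
  case (Suc k)
  have "gamma_cdf (Suc k) x \<le> gamma_cdf (Suc k) y"
  proof (rule DERIV_nonneg_imp_nondecreasing[OF assms(2)])
    fix t assume "x \<le> t" "t \<le> y"
    with assms show "\<exists>D. (gamma_cdf (Suc k) has_real_derivative D) (at t) \<and> 0 \<le> D"
      by (intro exI[of _ "t ^ k / fact k * exp (- t)"] conjI gamma_cdf_has_derivative) auto
  qed
  then show ?thesis by (simp add: Suc)
qed

lemma gamma_cdf_le_1: "0 \<le> y \<Longrightarrow> gamma_cdf m y \<le> 1"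
  by (auto simp: gamma_cdf_def exp_partial_sum_def intro!: mult_nonneg_nonneg sum_nonneg)

lemma gamma_cdf_at_0: "gamma_cdf m 0 = (if m = 0 then 1 else 0)"
  by (cases m) (auto simp: gamma_cdf_def exp_partial_sum_def lessThan_Suc_eq_insert_0 power_0_left
      sum.reindex)

lemma gamma_cdf_nonneg: "0 \<le> y \<Longrightarrow> 0 \<le> gamma_cdf m y"
  using gamma_cdf_mono[of 0 y m] by (auto simp: gamma_cdf_at_0 split: if_splits)

section \<open>Mean of the maximum of independent Gamma variables\<close>

text \<open>The mean of the maximum of independent variables $G_j / w_j$, $j \in I$, where every $G_j$ is
  Gamma distributed with shape \<open>m\<close> and rate 1.\<close>

definition mean_max_gamma :: "nat \<Rightarrow> ('i \<Rightarrow> real) \<Rightarrow> 'i set \<Rightarrow> ennreal" where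
  "mean_max_gamma m w I =
     (\<integral>\<^sup>+ u. ennreal (1 - (\<Prod>j\<in>I. gamma_cdf m (w j * u))) * indicator {0..} u \<partial>lborel)"

lemma prod_gamma_cdf_bounds:
  assumes "\<And>j. j \<in> I \<Longrightarrow> 0 \<le> w j" "0 \<le> u"
  shows "0 \<le> (\<Prod>j\<in>I. gamma_cdf m (w j * u))" "(\<Prod>j\<in>I. gamma_cdf m (w j * u)) \<le> 1"
  using assms by (auto intro!: prod_nonneg prod_le_1 gamma_cdf_nonneg gamma_cdf_le_1)

text \<open>For independent events of probabilities \<open>x\<close> and \<open>y\<close>,
  \<open>1 - x * y\<close> is the probability that at least one fails; the second inequality is the
  union bound.\<close>

lemma one_minus_mult_bounds:
  fixes x y :: real
  assumes "0 \<le> x" "x \<le> 1" "0 \<le> y" "y \<le> 1"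
  shows "1 - x \<le> 1 - x * y" "1 - x * y \<le> (1 - x) + (1 - y)"
proof -
  show "1 - x \<le> 1 - x * y"
    using assms mult_left_mono[of y 1 x] by simp
  have "0 \<le> (1 - x) * (1 - y)"
    using assms by (intro mult_nonneg_nonneg) auto
  then show "1 - x * y \<le> (1 - x) + (1 - y)"
    by (simp add: algebra_simps)
qed

text \<open>Two separate weight families are allowed because the interlaced sequence splits into
  \<open>d\<close> and \<open>b\<close>, both indexed by the same set \<open>{1..M}\<close>. The
  bounds hold pointwise in \<open>u\<close>.\<close>

lemma nn_integral_one_minus_prod_bounds:
  assumes "\<And>i. i \<in> I \<Longrightarrow> 0 \<le> v i" "\<And>j. j \<in> J \<Longrightarrow> 0 \<le> w j"
  shows "(\<integral>\<^sup>+ u. ennreal (1 - (\<Prod>i\<in>I. gamma_cdf m (v i * u)) * (\<Prod>j\<in>J. gamma_cdf m (w j * u)))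
      * indicator {0..} u \<partial>lborel) \<le> mean_max_gamma m v I + mean_max_gamma m w J" (is "?L \<le> ?R")
    and "mean_max_gamma m v I \<le> (\<integral>\<^sup>+ u. ennreal (1 - (\<Prod>i\<in>I. gamma_cdf m (v i * u)) *
      (\<Prod>j\<in>J. gamma_cdf m (w j * u))) * indicator {0..} u \<partial>lborel)"
proof -
  let ?F = "\<lambda>u. \<Prod>i\<in>I. gamma_cdf m (v i * u)" and ?G = "\<lambda>u. \<Prod>j\<in>J. gamma_cdf m (w j * u)"
  have bounds: "0 \<le> ?F u" "?F u \<le> 1" "0 \<le> ?G u" "?G u \<le> 1" if "0 \<le> u" for u
    using prod_gamma_cdf_bounds[of I v u m] prod_gamma_cdf_bounds[of J w u m] assms that by auto
  have "?L \<le> (\<integral>\<^sup>+ u. ennreal (1 - ?F u) * indicator {0..} u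
      + ennreal (1 - ?G u) * indicator {0..} u \<partial>lborel)"
    using bounds one_minus_mult_bounds(2)
    by (intro nn_integral_mono) (auto simp: ennreal_plus[symmetric] simp del: ennreal_plus
        split: split_indicator intro!: ennreal_leI)
  also have "\<dots> = ?R"
    unfolding mean_max_gamma_def by (intro nn_integral_add) measurable
  finally show "?L \<le> ?R" .
  show "mean_max_gamma m v I \<le> ?L"
    unfolding mean_max_gamma_def using bounds one_minus_mult_bounds(1)
    by (intro nn_integral_mono) (auto split: split_indicator intro!: ennreal_leI)
qed

lemma mean_max_gamma_Un:
  assumes "finite I" "finite J" "I \<inter> J = {}" "\<And>j. j \<in> I \<union> J \<Longrightarrow> 0 \<le> w j"
  shows "mean_max_gamma m w (I \<union> J) \<le> mean_max_gamma m w I + mean_max_gamma m w J"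
    and "mean_max_gamma m w I \<le> mean_max_gamma m w (I \<union> J)"
  using nn_integral_one_minus_prod_bounds[of I w J w m] assms
  by (auto simp: mean_max_gamma_def[of m w "I \<union> J"] prod.union_disjoint)

lemma mean_max_gamma_subset:
  assumes "finite J" "I \<subseteq> J" "\<And>j. j \<in> J \<Longrightarrow> 0 \<le> w j"
  shows "mean_max_gamma m w I \<le> mean_max_gamma m w J"
  using mean_max_gamma_Un(2)[of I "J - I" w m] assms
  by (auto simp: Un_absorb1 finite_subset Un_Diff_cancel)

text \<open>Larger rates make the variables \<open>G_j / w_j\<close> smaller.\<close>

lemma mean_max_gamma_antimono:
  assumes "\<And>j. j \<in> I \<Longrightarrow> 0 \<le> v j" "\<And>j. j \<in> I \<Longrightarrow> v j \<le> w j"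
  shows "mean_max_gamma m w I \<le> mean_max_gamma m v I"
  unfolding mean_max_gamma_def using assms
  by (intro nn_integral_mono)
    (auto split: split_indicator intro!: ennreal_leI prod_mono gamma_cdf_mono gamma_cdf_nonneg
      mult_right_mono)

text \<open>Substitute \<open>c * u\<close> for \<open>u\<close>: a factor common to all rates only
  changes the unit of time.\<close>

lemma mean_max_gamma_scale:
  assumes "0 < c"
  shows "mean_max_gamma m w I = ennreal c * mean_max_gamma m (\<lambda>j. c * w j) I"
  unfolding mean_max_gamma_def using assms
  by (subst nn_integral_real_affine[where c = c and t = 0])
    (auto simp: mult_ac zero_le_mult_iff indicator_def intro!: arg_cong2[of _ _ _ _ "(*)"] nn_integral_cong)

lemma mean_max_gamma_const_card:
  "card I = card J \<Longrightarrow> mean_max_gamma m (\<lambda>_. c) I = mean_max_gamma m (\<lambda>_. c) J"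
  by (simp add: mean_max_gamma_def)

text \<open>The Gamma density of shape \<open>k + 1\<close> has total mass 1. This yields the mean
  of a single variable and later turns a sum of probabilities into an integral.\<close>

lemma nn_integral_erlang:
  "(\<integral>\<^sup>+ u. ennreal (u ^ k / fact k * exp (- u)) * indicator {0..} u \<partial>lborel) = 1"
proof -
  have "(\<integral>\<^sup>+ u. ennreal (u ^ k / fact k * exp (- u)) * indicator {0..} u \<partial>lborel) =
      (\<integral>\<^sup>+ u. ennreal (1 / fact k) * (ennreal (u ^ k * exp (- u)) * indicator {0..} u) \<partial>lborel)"
    by (intro nn_integral_cong) (auto split: split_indicator simp: ennreal_mult[symmetric])
  also have "\<dots> = ennreal (1 / fact k) * ennreal (fact k)"
    by (subst nn_integral_cmult) (auto simp: nn_intergal_power_times_exp_Ici)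
  also have "\<dots> = 1"
    by (subst ennreal_mult[symmetric]) auto
  finally show ?thesis .
qed

lemma mean_max_gamma_singleton:
  assumes "0 < w i"
  shows "mean_max_gamma m w {i} = ennreal (m / w i)"
proof -
  have "mean_max_gamma m w {i} = ennreal (1 / w i) * mean_max_gamma m (\<lambda>j. 1 / w i * w j) {i}"
    using assms by (intro mean_max_gamma_scale) auto
  \<comment> \<open>At rate 1 the tail probability is itself a sum of \<open>m\<close> Erlang
    densities, each of integral 1.\<close>
  also have "mean_max_gamma m (\<lambda>j. 1 / w i * w j) {i} =
      (\<integral>\<^sup>+ u. (\<Sum>k<m. ennreal (u ^ k / fact k * exp (- u)) * indicator {0..} u) \<partial>lborel)"
    unfolding mean_max_gamma_def using assms
    by (intro nn_integral_cong)
      (auto simp: gamma_cdf_def exp_partial_sum_def sum_distrib_right lessThan_def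
        split: split_indicator)
  also have "\<dots> = of_nat m"
    by (subst nn_integral_sum) (auto simp: nn_integral_erlang simp del: times_divide_eq_left)
  finally show ?thesis
    using assms by (simp add: ennreal_of_nat_eq_real_of_nat ennreal_mult[symmetric])
qed

lemma mean_max_gamma_finite:
  assumes "finite I" "\<And>j. j \<in> I \<Longrightarrow> 0 < w j"
  shows "mean_max_gamma m w I < \<infinity>"
  using assms
proof (induction I)
  case empty
  then show ?case by (simp add: mean_max_gamma_def)
next
  case (insert i I)
  have "mean_max_gamma m w (insert i I) \<le> mean_max_gamma m w {i} + mean_max_gamma m w I"
    using mean_max_gamma_Un(1)[of "{i}" I w m] insert by (auto intro: less_imp_le)
  also have "\<dots> < \<infinity>"
    using insert by (auto simp: mean_max_gamma_singleton)
  finally show ?case .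
qed

text \<open>One variable already has the positive mean \<open>m / w i\<close>. Positivity ensures
  that the final quotient does not divide by 0.\<close>

lemma mean_max_gamma_pos:
  assumes "finite I" "I \<noteq> {}" "\<And>j. j \<in> I \<Longrightarrow> 0 < w j" "m \<ge> 1"
  shows "0 < mean_max_gamma m w I"
proof -
  obtain i where i: "i \<in> I" using assms(2) by auto
  have "0 < mean_max_gamma m w {i}"
    using assms i by (auto simp: mean_max_gamma_singleton)
  also have "\<dots> \<le> mean_max_gamma m w I"
    using assms i by (intro mean_max_gamma_subset) (auto intro: less_imp_le)
  finally show ?thesis .
qed

text \<open>The integrand is nonnegative, and both sides take the default value 0 if the integral
  diverges, so finiteness can be settled separately.\<close>

lemma set_integral_eq_mean_max_gamma:
  assumes "\<And>j. j \<in> I \<Longrightarrow> 0 \<le> w j"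
  shows "(LINT u:{0..}|lborel. 1 - (\<Prod>j\<in>I. 1 - exp_partial_sum m (w j * u) * exp (- (w j * u))))
    = enn2real (mean_max_gamma m w I)"
proof -
  have "(LINT u:{0..}|lborel. 1 - (\<Prod>j\<in>I. 1 - exp_partial_sum m (w j * u) * exp (- (w j * u))))
      = (LINT u|lborel. indicator {0..} u * (1 - (\<Prod>j\<in>I. gamma_cdf m (w j * u))))"
    by (simp add: set_lebesgue_integral_def gamma_cdf_def)
  also have "\<dots> = enn2real (\<integral>\<^sup>+ u. ennreal (indicator {0..} u * (1 - (\<Prod>j\<in>I. gamma_cdf m (w j * u)))) \<partial>lborel)"
    using prod_gamma_cdf_bounds(2)[of I w _ m] assms
    by (intro integral_eq_nn_integral) (auto split: split_indicator)
  also have "\<dots> = enn2real (mean_max_gamma m w I)"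
    unfolding mean_max_gamma_def
    by (intro arg_cong[of _ _ enn2real] nn_integral_cong) (auto split: split_indicator)
  finally show ?thesis .
qed

lemma mean_max_gamma_halves:
  fixes M :: nat
  shows "mean_max_gamma m (\<lambda>_. 1) {1..M} \<le> 2 * mean_max_gamma m (\<lambda>_. 1) {M div 2<..M}"
proof -
  have "mean_max_gamma m (\<lambda>_. 1) {1..M} \<le>
      mean_max_gamma m (\<lambda>_. 1) {1..M div 2} + mean_max_gamma m (\<lambda>_. 1) {M div 2<..M}"
  proof -
    have "{1..M} = {1..M div 2} \<union> {M div 2<..M}" by auto
    then show ?thesis
      using mean_max_gamma_Un(1)[of "{1..M div 2}" "{M div 2<..M}" "\<lambda>_. 1" m]
      by (auto simp: disjoint_iff)
  qed
  \<comment> \<open>With equal rates only the number of indices counts. The first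
    \<open>M div 2\<close> indices are exchanged for the last \<open>M div 2\<close>, which lie in
    the upper half even when \<open>M\<close> is odd.\<close>
  also have "mean_max_gamma m (\<lambda>_. 1) {1..M div 2} = mean_max_gamma m (\<lambda>_. 1) {M - M div 2<..M}"
    by (intro mean_max_gamma_const_card) auto
  also have "\<dots> \<le> mean_max_gamma m (\<lambda>_. 1) {M div 2<..M}"
    by (intro mean_max_gamma_subset) auto
  finally show ?thesis
    by (simp add: mult_2 add_right_mono)
qed

section \<open>Exponential generating functions with quotas\<close>

text \<open>The expansion of \<open>exp (c * s) - exp_partial_sum k (c * s)\<close> in
  \<open>s\<close>: the exponential generating function for one type of weight \<open>c\<close>
  drawn at least \<open>k\<close> times.\<close>

definition exp_tail_fps :: "real \<Rightarrow> nat \<Rightarrow> real fps" where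
  "exp_tail_fps c k = Abs_fps (\<lambda>n. if n < k then 0 else c ^ n / fact n)"

text \<open>Truncated subtraction is right at \<open>k = 0\<close>: the series is then the full
  exponential, which differentiation reproduces up to the factor \<open>c\<close>.\<close>

lemma exp_tail_fps_deriv:
  "fps_deriv (exp_tail_fps c k) = fps_const c * exp_tail_fps c (k - 1)"
proof (rule fps_ext)
  fix n
  have "real (Suc n) * (c ^ Suc n / fact (Suc n)) = c * (c ^ n / fact n)"
    unfolding fact_Suc of_nat_mult by (simp del: of_nat_Suc)
  then show "fps_deriv (exp_tail_fps c k) $ n = (fps_const c * exp_tail_fps c (k - 1)) $ n"
    by (auto simp: exp_tail_fps_def simp del: of_nat_Suc fact_Suc power_Suc)
qed

lemma exp_tail_fps_sums:
  "(\<lambda>n. exp_tail_fps c k $ n * s ^ n) sums (exp (c * s) - exp_partial_sum k (c * s))"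
proof -
  have "(\<lambda>n. (c * s) ^ n / fact n) sums exp (c * s)"
    using exp_converges[of "c * s"] by (simp add: field_simps)
  moreover have "(\<lambda>n. if n \<in> {..<k} then (c * s) ^ n / fact n else 0) sums exp_partial_sum k (c * s)"
    unfolding exp_partial_sum_def by (rule sums_If_finite_set) auto
  ultimately have "(\<lambda>n. (c * s) ^ n / fact n - (if n \<in> {..<k} then (c * s) ^ n / fact n else 0))
      sums (exp (c * s) - exp_partial_sum k (c * s))"
    by (rule sums_diff)
  then show ?thesis
    by (rule sums_cong[THEN iffD1, rotated]) (auto simp: exp_tail_fps_def power_mult_distrib)
qed

lemma exp_tail_fps_conv_radius: "fps_conv_radius (exp_tail_fps c k) = \<infinity>"
  unfolding fps_conv_radius_def
  using exp_tail_fps_sums by (intro conv_radius_inftyI'') (auto simp: sums_iff)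

text \<open>The infinite radius of convergence is carried through the induction, since evaluation is
  multiplicative where both factors converge.\<close>

lemma prod_exp_tail_fps_sums:
  fixes s :: real
  assumes "finite I"
  shows "(\<lambda>n. fps_nth (\<Prod>j\<in>I. exp_tail_fps (c j) (r j)) n * s ^ n) sums
    (\<Prod>j\<in>I. exp (c j * s) - exp_partial_sum (r j) (c j * s))"
proof -
  have "fps_conv_radius (\<Prod>j\<in>I. exp_tail_fps (c j) (r j)) = \<infinity> \<and>
    eval_fps (\<Prod>j\<in>I. exp_tail_fps (c j) (r j)) s =
      (\<Prod>j\<in>I. exp (c j * s) - exp_partial_sum (r j) (c j * s))"
    using assms
  proof (induction I)
    case empty
    then show ?case by simp
  next
    case (insert i I)
    let ?F = "exp_tail_fps (c i) (r i)" and ?G = "\<Prod>j\<in>I. exp_tail_fps (c j) (r j)"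
    have "eval_fps ?F s = exp (c i * s) - exp_partial_sum (r i) (c i * s)"
      using exp_tail_fps_sums[of "c i" "r i" s] by (simp add: eval_fps_def sums_iff)
    moreover have "fps_conv_radius (?F * ?G) = \<infinity>"
      using fps_conv_radius_mult[of ?F ?G] insert.IH exp_tail_fps_conv_radius[of "c i" "r i"] by auto
    ultimately show ?case
      using insert by (simp add: eval_fps_mult exp_tail_fps_conv_radius)
  qed
  then show ?thesis
    using sums_eval_fps[of s "\<Prod>j\<in>I. exp_tail_fps (c j) (r j)"] by simp
qed

lemma fps_deriv_prod:
  fixes F :: "'i \<Rightarrow> 'a :: comm_ring_1 fps"
  assumes "finite I"
  shows "fps_deriv (\<Prod>j\<in>I. F j) = (\<Sum>j\<in>I. fps_deriv (F j) * (\<Prod>i\<in>I - {j}. F i))"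
  using assms
proof (induction I)
  case empty
  then show ?case by simp
next
  case (insert k I)
  have "fps_deriv (F j) * (\<Prod>i\<in>insert k I - {j}. F i) =
      F k * (fps_deriv (F j) * (\<Prod>i\<in>I - {j}. F i))" if "j \<in> I" for j
  proof -
    have "insert k I - {j} = insert k (I - {j})" using insert that by auto
    then show ?thesis using insert by (simp add: mult_ac)
  qed
  then show ?case
    using insert by (simp add: sum_distrib_left mult_ac)
qed

text \<open>Differentiating the factor \<open>i\<close> lowers its quota by one and produces the
  weight \<open>c i\<close>, just as a first draw of type \<open>i\<close> does.\<close>

lemma prod_exp_tail_fps_deriv:
  assumes "finite I"
  shows "fps_deriv (\<Prod>j\<in>I. exp_tail_fps (c j) (r j)) =
    (\<Sum>i\<in>I. fps_const (c i) * (\<Prod>j\<in>I. exp_tail_fps (c j) ((r(i := r i - 1)) j)))"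
  unfolding fps_deriv_prod[OF assms]
proof (rule sum.cong)
  fix i assume i: "i \<in> I"
  have "(\<Prod>j\<in>I. exp_tail_fps (c j) ((r(i := r i - 1)) j)) =
      exp_tail_fps (c i) (r i - 1) * (\<Prod>j\<in>I - {i}. exp_tail_fps (c j) (r j))"
    by (subst prod.remove[OF assms i]) (auto intro!: arg_cong2[of _ _ _ _ "(*)"] prod.cong)
  then show "fps_deriv (exp_tail_fps (c i) (r i)) * (\<Prod>j\<in>I - {i}. exp_tail_fps (c j) (r j)) =
      fps_const (c i) * (\<Prod>j\<in>I. exp_tail_fps (c j) ((r(i := r i - 1)) j))"
    by (simp add: exp_tail_fps_deriv mult_ac)
qed simp

section \<open>Completion probabilities after a fixed number of draws\<close>

definition draws :: "'a pmf \<Rightarrow> (nat \<Rightarrow> 'a) measure" where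
  "draws p = PiM (UNIV :: nat set) (\<lambda>_. measure_pmf p)"

text \<open>The quotas depend on the type because the first draw lowers the quota of its own type only.\<close>

definition collected :: "('a \<Rightarrow> nat) \<Rightarrow> 'a set \<Rightarrow> nat \<Rightarrow> (nat \<Rightarrow> 'a) set" where
  "collected r I n = {\<omega>. \<forall>j\<in>I. r j \<le> card {i. i < n \<and> \<omega> i = j}}"

lemma space_draws [simp]: "space (draws p) = UNIV"
  by (auto simp: draws_def space_PiM)

lemma draws_prob_space: "prob_space (draws p)"
  unfolding draws_def by (intro prob_space_PiM) (rule measure_pmf.prob_space_axioms)

lemma draws_component_measurable [measurable]: "(\<lambda>\<omega>. \<omega> i) \<in> draws p \<rightarrow>\<^sub>M count_space UNIV"
proof -
  have "(\<lambda>\<omega>. \<omega> i) \<in> draws p \<rightarrow>\<^sub>M measure_pmf p"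
    unfolding draws_def by (rule measurable_component_singleton) simp
  then show ?thesis by (simp cong: measurable_cong_sets)
qed

lemma collected_sets [measurable]:
  assumes "finite I"
  shows "collected r I n \<in> sets (draws p)"
proof -
  \<comment> \<open>As a finite sum of indicators, the count is visibly a measurable function of
    finitely many coordinates.\<close>
  have card: "card {i. i < n \<and> \<omega> i = j} = (\<Sum>i<n. if \<omega> i = j then 1 else 0)" for \<omega> and j :: 'a
    by (subst card_eq_sum) (simp add: sum.If_cases lessThan_def Collect_conj_eq)
  have "{\<omega> \<in> space (draws p). \<forall>j\<in>I. r j \<le> (\<Sum>i<n. if \<omega> i = j then 1 else 0)} \<in> sets (draws p)"
    using assms by measurable
  then show ?thesis
    by (simp add: collected_def card)
qed

text \<open>A prepended draw of \<open>x\<close> counts once towards the quota of \<open>x\<close>;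
  truncated subtraction leaves a quota that is already 0 at 0.\<close>

lemma case_nat_in_collected:
  "case_nat x \<omega> \<in> collected r I (Suc n) \<longleftrightarrow> \<omega> \<in> collected (r(x := r x - 1)) I n"
proof -
  have "card {i. i < Suc n \<and> case_nat x \<omega> i = j} =
      card {i. i < n \<and> \<omega> i = j} + (if x = j then 1 else 0)" for j
  proof -
    have "{i. i < Suc n \<and> case_nat x \<omega> i = j} =
        Suc ` {i. i < n \<and> \<omega> i = j} \<union> (if x = j then {0} else {})"
      by (auto simp: less_Suc_eq_0_disj)
    then show ?thesis
      by (simp add: card_image)
  qed
  then show ?thesis
    by (auto simp: collected_def)
qed

text \<open>The product measure is unchanged when an independent draw is put in front. Fubini
  conditions on that draw, and the support condition makes the outer integral a finite sum.\<close>

lemma prob_collected_Suc: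
  assumes "finite I" "set_pmf p \<subseteq> I"
  shows "measure (draws p) (collected r I (Suc n)) =
    (\<Sum>i\<in>I. pmf p i * measure (draws p) (collected (r(i := r i - 1)) I n))"
proof -
  interpret sequence_space "measure_pmf p" ..
  interpret D: prob_space "draws p" by (rule draws_prob_space)
  have iter: "distr (measure_pmf p \<Otimes>\<^sub>M draws p) (draws p) (\<lambda>(x, \<omega>). case_nat x \<omega>) = draws p"
    unfolding draws_def by (rule PiM_iter)
  have meas: "(\<lambda>(x, \<omega>). case_nat x \<omega>) \<in> measure_pmf p \<Otimes>\<^sub>M draws p \<rightarrow>\<^sub>M draws p"
    unfolding draws_def by measurable
  have "emeasure (draws p) (collected r I (Suc n)) =
      emeasure (measure_pmf p \<Otimes>\<^sub>M draws p)
        ((\<lambda>(x, \<omega>). case_nat x \<omega>) -` collected r I (Suc n) \<inter> space (measure_pmf p \<Otimes>\<^sub>M draws p))"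
    by (subst iter[symmetric], subst emeasure_distr[OF meas]) (auto simp: assms)
  also have "\<dots> = (\<integral>\<^sup>+ x. emeasure (draws p) (collected (r(x := r x - 1)) I n) \<partial>measure_pmf p)"
    using measurable_sets[OF meas collected_sets[OF assms(1)], of r "Suc n"]
    by (subst D.emeasure_pair_measure_alt)
      (auto intro!: nn_integral_cong arg_cong[of _ _ "emeasure (draws p)"]
        simp: assms case_nat_in_collected space_pair_measure simp del: fun_upd_apply)
  also have "\<dots> = ennreal (\<Sum>i\<in>I. pmf p i * measure (draws p) (collected (r(i := r i - 1)) I n))"
    using assms
    by (subst nn_integral_measure_pmf_support[of I])
      (auto simp: D.emeasure_eq_measure ennreal_mult[symmetric] sum_nonneg mult.commute)
  finally show ?thesis
    by (simp add: D.emeasure_eq_measure sum_nonneg)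
qed

lemma fps_nth_0_prod:
  fixes F :: "'i \<Rightarrow> 'a :: comm_ring_1 fps"
  shows "(\<Prod>j\<in>I. F j) $ 0 = (\<Prod>j\<in>I. F j $ 0)"
  by (induction I rule: infinite_finite_induct) auto

text \<open>Both sides obey the same recurrence in \<open>n\<close>. The quotas \<open>r\<close>
  stay arbitrary in the induction because the recurrence changes them.\<close>

lemma prob_collected_eq_fps_nth:
  assumes "finite I" "set_pmf p \<subseteq> I"
  shows "measure (draws p) (collected r I n) =
    fact n * fps_nth (\<Prod>j\<in>I. exp_tail_fps (pmf p j) (r j)) n"
proof (induction n arbitrary: r)
  case 0
  \<comment> \<open>No draws suffice exactly when all quotas vanish; correspondingly a factor has
    constant coefficient 1 for quota 0 and 0 otherwise.\<close>
  have eq: "collected r I 0 = (if \<forall>j\<in>I. r j = 0 then UNIV else {})"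
    by (auto simp: collected_def)
  show ?case
    using assms(1) prob_space.prob_space[OF draws_prob_space[of p]]
    by (auto simp: eq fps_nth_0_prod exp_tail_fps_def)
next
  case (Suc n)
  let ?G = "\<lambda>r. \<Prod>j\<in>I. exp_tail_fps (pmf p j) (r j)"
  have "fact (Suc n) * ?G r $ Suc n = fact n * (fps_deriv (?G r) $ n)"
    by (simp add: algebra_simps)
  also have "\<dots> = (\<Sum>i\<in>I. pmf p i * (fact n * ?G (r(i := r i - 1)) $ n))"
    unfolding prod_exp_tail_fps_deriv[OF assms(1)]
    by (simp add: fps_sum_nth sum_distrib_left mult_ac del: fun_upd_apply)
  finally show ?case
    unfolding prob_collected_Suc[OF assms] Suc.IH by simp
qed

text \<open>Poissonization: after a Poisson number of draws with mean \<open>u\<close>, the counts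
  of the types are independent Poisson variables with means \<open>pmf p j * u\<close>, so
  completion factors over the types.\<close>

lemma collected_poissonized_sums:
  assumes "finite I" "set_pmf p \<subseteq> I"
  shows "(\<lambda>n. u ^ n / fact n * exp (- u) * (1 - measure (draws p) (collected (\<lambda>_. m) I n))) sums
    (1 - (\<Prod>j\<in>I. gamma_cdf m (pmf p j * u)))"
proof -
  let ?q = "\<lambda>n. measure (draws p) (collected (\<lambda>_. m) I n)"
  let ?P = "\<Prod>j\<in>I. exp (pmf p j * u) - exp_partial_sum m (pmf p j * u)"
  have exp: "(\<lambda>n. u ^ n / fact n) sums exp u"
    using exp_converges[of u] by (simp add: field_simps)
  have "(\<lambda>n. u ^ n / fact n * ?q n) sums ?P"
    using prod_exp_tail_fps_sums[OF assms(1), of "pmf p" "\<lambda>_. m" u]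
    by (simp add: prob_collected_eq_fps_nth[OF assms] mult_ac)
  from sums_mult2[OF sums_diff[OF exp this], of "exp (- u)"]
  have "(\<lambda>n. u ^ n / fact n * exp (- u) * (1 - ?q n)) sums ((exp u - ?P) * exp (- u))"
    by (simp add: algebra_simps diff_divide_distrib)
  \<comment> \<open>The probabilities over \<open>I\<close> sum to 1, so \<open>exp (- u)\<close>
    can be distributed over the factors.\<close>
  moreover have "exp (- u) = (\<Prod>j\<in>I. exp (- (pmf p j * u)))"
    using sum_pmf_eq_1[OF assms] assms(1)
    by (simp add: exp_sum[symmetric] sum_negf sum_distrib_right[symmetric])
  then have "?P * exp (- u) = (\<Prod>j\<in>I. gamma_cdf m (pmf p j * u))"
    by (simp add: prod.distrib[symmetric] gamma_cdf_def algebra_simps exp_minus)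
  ultimately show ?thesis
    by (simp add: algebra_simps exp_minus)
qed

section \<open>Integral formula for the expected collection time\<close>

lemma suminf_prob_not_collected:
  assumes "finite I" "set_pmf p \<subseteq> I"
  shows "(\<Sum>n. emeasure (draws p) (- collected (\<lambda>_. m) I n)) = mean_max_gamma m (pmf p) I"
proof -
  interpret D: prob_space "draws p" by (rule draws_prob_space)
  let ?q = "\<lambda>n. measure (draws p) (collected (\<lambda>_. m) I n)"
  let ?e = "\<lambda>n u. ennreal (u ^ n / fact n * exp (- u)) * indicator {0..} u"
  \<comment> \<open>Each probability is multiplied by 1, written as the integral of the Erlang
    density with the same index \<open>n\<close>; the sum then passes under the integral by
    nonnegativity.\<close>
  have "emeasure (draws p) (- collected (\<lambda>_. m) I n) = (\<integral>\<^sup>+ u. ?e n u * ennreal (1 - ?q n) \<partial>lborel)" for n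
    using D.prob_compl[OF collected_sets[OF assms(1)], of "\<lambda>_. m" n]
    by (subst nn_integral_multc) (auto simp: nn_integral_erlang D.emeasure_eq_measure Compl_eq_Diff_UNIV
        simp del: times_divide_eq_left)
  then have "(\<Sum>n. emeasure (draws p) (- collected (\<lambda>_. m) I n)) =
      (\<Sum>n. \<integral>\<^sup>+ u. ?e n u * ennreal (1 - ?q n) \<partial>lborel)"
    by simp
  also have "\<dots> = (\<integral>\<^sup>+ u. (\<Sum>n. ?e n u * ennreal (1 - ?q n)) \<partial>lborel)"
    by (subst nn_integral_suminf) auto
  also have "\<dots> = mean_max_gamma m (pmf p) I"
    unfolding mean_max_gamma_def
  proof (intro nn_integral_cong)
    fix u :: real
    show "(\<Sum>n. ?e n u * ennreal (1 - ?q n)) =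
        ennreal (1 - (\<Prod>j\<in>I. gamma_cdf m (pmf p j * u))) * indicator {0..} u"
    proof (cases "0 \<le> u")
      case True
      then have "(\<Sum>n. ?e n u * ennreal (1 - ?q n)) =
          (\<Sum>n. ennreal (u ^ n / fact n * exp (- u) * (1 - ?q n)))"
        by (simp add: ennreal_mult[symmetric] del: times_divide_eq_left)
      also have "\<dots> = ennreal (1 - (\<Prod>j\<in>I. gamma_cdf m (pmf p j * u)))"
        using True by (intro suminf_ennreal_eq[OF _ collected_poissonized_sums[OF assms]])
          (auto intro!: mult_nonneg_nonneg)
      finally show ?thesis using True by simp
    qed simp
  qed
  finally show ?thesis .
qed

lemma collected_mono: "n \<le> n' \<Longrightarrow> collected r I n \<subseteq> collected r I n'"
proof
  fix \<omega> assume n: "n \<le> n'" and \<omega>: "\<omega> \<in> collected r I n"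
  have "card {i. i < n \<and> \<omega> i = j} \<le> card {i. i < n' \<and> \<omega> i = j}" for j
    using n by (intro card_mono) auto
  with \<omega> show "\<omega> \<in> collected r I n'"
    unfolding collected_def using order.trans by blast
qed

lemma collect_time_eq_INF:
  "collect_time m N \<omega> = (INF n \<in> {n. \<omega> \<in> collected (\<lambda>_. m) {1..N} n}. enat n)"
  by (simp add: collect_time_def collected_def)

text \<open>Completion persists under further draws, so the infimum exceeds \<open>n\<close> as soon
  as \<open>n\<close> fails. A collection that is never completed fits in: its infimum is infinite
  and every \<open>n\<close> fails.\<close>

lemma less_collect_time_iff:
  "enat n < collect_time m N \<omega> \<longleftrightarrow> \<omega> \<notin> collected (\<lambda>_. m) {1..N} n"
proof
  assume "enat n < collect_time m N \<omega>"
  then show "\<omega> \<notin> collected (\<lambda>_. m) {1..N} n"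
    unfolding collect_time_eq_INF by (auto dest: less_INF_D)
next
  assume *: "\<omega> \<notin> collected (\<lambda>_. m) {1..N} n"
  have "enat (Suc n) \<le> collect_time m N \<omega>"
    unfolding collect_time_eq_INF
  proof (rule INF_greatest)
    fix n' assume "n' \<in> {n. \<omega> \<in> collected (\<lambda>_. m) {1..N} n}"
    with * collected_mono[of n' n "\<lambda>_. m" "{1..N}"] have "\<not> n' \<le> n" by auto
    then show "enat (Suc n) \<le> enat n'" by simp
  qed
  then show "enat n < collect_time m N \<omega>"
    by (rule less_le_trans[rotated]) simp
qed

text \<open>The index set of the infimum depends on \<open>\<omega>\<close>. Giving excluded indices
  the value \<top> makes it an infimum over all \<open>n\<close> of measurable functions.\<close>

lemma collect_time_measurable:
  "collect_time m N \<in> draws p \<rightarrow>\<^sub>M count_space UNIV"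
proof -
  have "collect_time m N =
      (\<lambda>\<omega>. INF n. if \<omega> \<in> collected (\<lambda>_. m) {1..N} n then enat n else \<top>)"
    (is "_ = ?R")
  proof (rule ext)
    fix \<omega>
    show "collect_time m N \<omega> = ?R \<omega>"
      unfolding collect_time_eq_INF
    proof (rule antisym)
      show "(INF n \<in> {n. \<omega> \<in> collected (\<lambda>_. m) {1..N} n}. enat n) \<le> ?R \<omega>"
        by (intro INF_greatest) (auto intro: INF_lower)
      show "?R \<omega> \<le> (INF n \<in> {n. \<omega> \<in> collected (\<lambda>_. m) {1..N} n}. enat n)"
      proof (rule INF_greatest)
        fix n assume "n \<in> {n. \<omega> \<in> collected (\<lambda>_. m) {1..N} n}"
        then show "?R \<omega> \<le> enat n" by (intro INF_lower2[of n]) auto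
      qed
    qed
  qed
  moreover have "(\<lambda>\<omega>. INF n. if \<omega> \<in> collected (\<lambda>_. m) {1..N} n then enat n else \<top>)
      \<in> draws p \<rightarrow>\<^sub>M count_space UNIV"
    by (intro measurable_INF measurable_If) (auto simp: collected_sets)
  ultimately show ?thesis by simp
qed

lemma expected_collect_time_eq:
  assumes "N \<ge> 1" "\<And>j. j \<in> {1..N} \<Longrightarrow> 0 < a j"
  shows "expected_collect_time m N a = ennreal (\<Sum>j=1..N. a j) * mean_max_gamma m a {1..N}"
proof -
  let ?p = "coupon_pmf N a" and ?A = "\<Sum>j=1..N. a j"
  let ?f = "\<lambda>j. if j \<in> {1..N} then a j / ?A else 0"
  have A: "0 < ?A"
    using assms by (intro sum_pos) auto
  \<comment> \<open>\<open>embed_pmf\<close> has the prescribed values only once the function is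
    known to be nonnegative with total mass 1.\<close>
  have pmf: "pmf ?p j = ?f j" for j
    unfolding coupon_pmf_def
  proof (rule pmf_embed_pmf)
    show "0 \<le> ?f j" for j
      using A assms by (auto intro: less_imp_le)
    have "(\<integral>\<^sup>+ j. ennreal (?f j) \<partial>count_space UNIV) = (\<Sum>j\<in>{1..N}. ennreal (?f j))"
      by (rule nn_integral_count_space') auto
    also have "\<dots> = ennreal (\<Sum>j=1..N. a j / ?A)"
      using A assms by (subst sum_ennreal) (auto intro: less_imp_le)
    also have "\<dots> = 1"
      using A by (simp add: sum_divide_distrib[symmetric])
    finally show "(\<integral>\<^sup>+ j. ennreal (?f j) \<partial>count_space UNIV) = 1" .
  qed
  then have supp: "set_pmf ?p \<subseteq> {1..N}"
    by (auto simp: set_pmf_iff split: if_splits)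
  have "expected_collect_time m N a = (\<integral>\<^sup>+ \<omega>. ennreal_of_enat (collect_time m N \<omega>) \<partial>draws ?p)"
    by (simp add: expected_collect_time_def coupon_space_def draws_def)
  \<comment> \<open>The expectation of a variable with values in \<open>enat\<close> is the sum of
    its tail probabilities.\<close>
  also have "\<dots> = (\<Sum>n. emeasure (draws ?p) {\<omega> \<in> space (draws ?p). enat n < collect_time m N \<omega>})"
    by (rule nn_integral_enat_function) (rule collect_time_measurable)
  also have "\<dots> = mean_max_gamma m (pmf ?p) {1..N}"
    using suminf_prob_not_collected[OF _ supp] by (simp add: less_collect_time_iff Compl_eq)
  also have "\<dots> = mean_max_gamma m (\<lambda>j. a j / ?A) {1..N}"
    by (simp add: mean_max_gamma_def pmf)
  also have "\<dots> = ennreal ?A * mean_max_gamma m a {1..N}"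
    using A by (subst mean_max_gamma_scale[OF A]) (simp add: mean_max_gamma_def)
  finally show ?thesis .
qed

section \<open>Comparison of the two interlaced sequences\<close>

lemma positive_lower_bound_of_tendsto_at_top:
  fixes b :: "nat \<Rightarrow> real"
  assumes "\<And>j. j \<ge> 1 \<Longrightarrow> b j > 0" "filterlim b at_top sequentially"
  obtains c where "0 < c" "\<And>j. j \<ge> 1 \<Longrightarrow> c \<le> b j"
proof -
  from assms(2) have "eventually (\<lambda>j. 1 \<le> b j) sequentially"
    by (simp add: filterlim_at_top)
  then obtain n where n: "\<And>j. j \<ge> n \<Longrightarrow> 1 \<le> b j"
    by (auto simp: eventually_sequentially)
  \<comment> \<open>The element 1 bounds the tail and keeps the set nonempty.\<close>
  define c where "c = Min (insert 1 (b ` {1..<n}))"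
  have "0 < c"
    unfolding c_def using assms(1) by (subst Min_gr_iff) auto
  moreover have "c \<le> b j" if "j \<ge> 1" for j
  proof (cases "j < n")
    case True
    then show ?thesis unfolding c_def using that by (intro Min_le) auto
  next
    case False
    have "c \<le> 1" unfolding c_def by (intro Min_le) auto
    with n[of j] False show ?thesis by auto
  qed
  ultimately show ?thesis using that by blast
qed

lemma prod_interlaced:
  fixes g :: "nat \<Rightarrow> 'a :: comm_monoid_mult"
  shows "(\<Prod>j=1..2 * M. g j) = (\<Prod>j=1..M. g (2 * j)) * (\<Prod>j=1..M. g (2 * j - 1))"
  by (induction M) (simp_all add: mult_ac)

lemma sum_interlaced:
  fixes g :: "nat \<Rightarrow> 'a :: comm_monoid_add"
  shows "(\<Sum>j=1..2 * M. g j) = (\<Sum>j=1..M. g (2 * j)) + (\<Sum>j=1..M. g (2 * j - 1))"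
  by (induction M) (simp_all add: add_ac)

text \<open>Both sides are compared with rate 1: \<open>b\<close> is lowered to \<open>c\<close>,
  \<open>d\<close> is raised to \<open>e\<close> on the upper half only. Rescaling gives
  \<open>e / c\<close>, and dropping the lower half costs the factor 2.\<close>

lemma mean_max_gamma_ratio_bound:
  fixes b d :: "nat \<Rightarrow> real"
  assumes "0 < c" "\<And>j. j \<in> {1..M} \<Longrightarrow> c \<le> b j" "0 < e" "\<And>j. j \<in> {1..M} \<Longrightarrow> 0 < d j"
    and "\<And>j. j \<in> {M div 2<..M} \<Longrightarrow> d j \<le> e"
  shows "mean_max_gamma m b {1..M} \<le> ennreal (2 * e / c) * mean_max_gamma m d {1..M}"
proof -
  let ?K = "mean_max_gamma m (\<lambda>_. 1 :: real)"
  have "mean_max_gamma m b {1..M} \<le> mean_max_gamma m (\<lambda>_. c) {1..M}"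
    using assms by (intro mean_max_gamma_antimono) auto
  also have "\<dots> = ennreal (1 / c) * ?K {1..M}"
    using assms by (subst mean_max_gamma_scale[of "1 / c"]) auto
  also have "\<dots> \<le> ennreal (1 / c) * (2 * ?K {M div 2<..M})"
    by (intro mult_left_mono mean_max_gamma_halves) auto
  also have "?K {M div 2<..M} = ennreal e * mean_max_gamma m (\<lambda>_. e) {M div 2<..M}"
    using assms by (subst mean_max_gamma_scale[of e]) auto
  also have "ennreal (1 / c) * (2 * (ennreal e * mean_max_gamma m (\<lambda>_. e) {M div 2<..M})) =
      ennreal (2 * e / c) * mean_max_gamma m (\<lambda>_. e) {M div 2<..M}"
  proof -
    have "ennreal (2 * e / c) = ennreal (1 / c) * (ennreal 2 * ennreal e)"
      using assms by (simp add: ennreal_mult[symmetric] del: ennreal_numeral)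
    then show ?thesis by (simp add: mult_ac)
  qed
  also have "\<dots> \<le> ennreal (2 * e / c) * mean_max_gamma m d {M div 2<..M}"
    using assms by (intro mult_left_mono mean_max_gamma_antimono) (auto intro: less_imp_le)
  also have "\<dots> \<le> ennreal (2 * e / c) * mean_max_gamma m d {1..M}"
    using assms by (intro mult_left_mono mean_max_gamma_subset) (auto intro: less_imp_le)
  finally show ?thesis .
qed

theorem theorem1:
  fixes m :: nat
    and a b d :: "nat \<Rightarrow> real"
    and f f' f'' f''' :: "real \<Rightarrow> real"
  assumes "m \<ge> 1"
    and "\<And>j. j \<ge> 1 \<Longrightarrow> b j > 0"
    and "filterlim b at_top sequentially"
    and "\<And>j. j \<ge> 1 \<Longrightarrow> d j = 1 / f (real j)"
    and "\<And>x. x > 0 \<Longrightarrow> (f has_real_derivative f' x) (at x)"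
    and "\<And>x. x > 0 \<Longrightarrow> (f' has_real_derivative f'' x) (at x)"
    and "\<And>x. x > 0 \<Longrightarrow> (f'' has_real_derivative f''' x) (at x)"
    and "continuous_on {0<..} f'''"
    and "\<And>x. x > 0 \<Longrightarrow> f x > 0"
    and "\<And>x. x > 0 \<Longrightarrow> f' x > 0"
    and "filterlim f at_top at_top"
    and "((\<lambda>x. f' x / f x) \<longlongrightarrow> 0) at_top"
    and "(\<lambda>x. (f'' x / f' x) / (f' x / f x)) \<in> O[at_top](\<lambda>_. 1)"
    and "(\<lambda>x. f''' x * (f x)\<^sup>2 / (f' x) ^ 3) \<in> O[at_top](\<lambda>_. 1)"
    and "\<And>j. j \<ge> 1 \<Longrightarrow> a (2 * j - 1) = b j"
    and "\<And>j. j \<ge> 1 \<Longrightarrow> a (2 * j) = d j"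
  shows "seq_asymp
    (\<lambda>M. enn2real (expected_collect_time m (2 * M) a))
    (\<lambda>M. ((\<Sum>j=1..M. d j) + (\<Sum>j=1..M. b j)) *
      (LINT u:{0..}|lborel. 1 - (\<Prod>j=1..M. 1 - exp_partial_sum m (d j * u) * exp (- (d j * u)))))"
proof -
  note m = assms(1) and b_pos = assms(2) and d_eq = assms(4) and f_deriv = assms(5)
    and f_pos = assms(9) and f'_pos = assms(10) and a_odd = assms(15) and a_even = assms(16)
  obtain c where c: "0 < c" "\<And>j. j \<ge> 1 \<Longrightarrow> c \<le> b j"
    using positive_lower_bound_of_tendsto_at_top[OF b_pos assms(3)] by blast
  have d_pos: "0 < d j" if "j \<ge> 1" for j
    using that d_eq f_pos by simp
  have a_pos: "0 < a j" if "j \<ge> 1" for j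
  proof (cases "even j")
    case True
    then obtain i where "j = 2 * i" by (elim evenE)
    with that show ?thesis using a_even[of i] d_pos[of i] by simp
  next
    case False
    then obtain i where "j = 2 * i + 1" by (elim oddE)
    then show ?thesis using a_odd[of "Suc i"] b_pos[of "Suc i"] by simp
  qed
  have f_mono: "f x \<le> f y" if "0 < x" "x \<le> y" for x y
    using that by (intro DERIV_nonneg_imp_nondecreasing[of x y f])
      (auto intro!: exI f_deriv less_imp_le[OF f'_pos])
  define S where "S M = (\<Sum>j=1..M. d j) + (\<Sum>j=1..M. b j)" for M
  define X where "X M = enn2real (expected_collect_time m (2 * M) a)" for M
  define D where "D M = enn2real (mean_max_gamma m d {1..M})" for M
  \<comment> \<open>This is \<open>2 * e / c\<close> for \<open>e = 1 / f (M div 2)\<close>, a bound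
    for \<open>d j\<close> on the upper half because \<open>f\<close> increases.\<close>
  define \<epsilon> where "\<epsilon> M = 2 / (c * f (real (M div 2)))" for M
  \<comment> \<open>For \<open>M\<close> \<ge> 2 the argument \<open>M div 2\<close> is positive,
    where \<open>f\<close> is known to be positive and increasing.\<close>
  have bounds: "1 \<le> X M / (S M * D M)" "X M / (S M * D M) \<le> 1 + \<epsilon> M" if M: "M \<ge> 2" for M
  proof -
    let ?B = "mean_max_gamma m b {1..M}" and ?D = "mean_max_gamma m d {1..M}"
    let ?T = "mean_max_gamma m a {1..2 * M}"
    have S_pos: "0 < S M"
      unfolding S_def using M d_pos b_pos by (intro add_pos_pos sum_pos) auto
    have "S M = (\<Sum>j=1..2 * M. a j)"
      unfolding S_def sum_interlaced by (simp add: a_even a_odd[simplified])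
    then have E: "expected_collect_time m (2 * M) a = ennreal (S M) * ?T"
      using expected_collect_time_eq[of "2 * M" a m] M a_pos by simp
    have T_eq: "?T = (\<integral>\<^sup>+ u. ennreal (1 - (\<Prod>j=1..M. gamma_cdf m (d j * u)) *
        (\<Prod>j=1..M. gamma_cdf m (b j * u))) * indicator {0..} u \<partial>lborel)"
      unfolding mean_max_gamma_def prod_interlaced by (simp add: a_even a_odd[simplified])
    have "?T \<le> ?D + ?B" "?D \<le> ?T"
      unfolding T_eq using d_pos b_pos
      by (auto intro!: nn_integral_one_minus_prod_bounds intro: less_imp_le)
    have "?B \<le> ennreal (2 * (1 / f (real (M div 2))) / c) * ?D"
    proof (rule mean_max_gamma_ratio_bound)
      show "0 < 1 / f (real (M div 2))"
        using M f_pos by simp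
      show "d j \<le> 1 / f (real (M div 2))" if "j \<in> {M div 2<..M}" for j
        using that M f_mono[of "real (M div 2)" "real j"] f_pos d_eq[of j]
        by (auto intro!: divide_left_mono)
    qed (use c d_pos in auto)
    also have "2 * (1 / f (real (M div 2))) / c = \<epsilon> M"
      by (simp add: \<epsilon>_def field_simps)
    finally have "?B \<le> ennreal (\<epsilon> M) * ?D" .
    have \<epsilon>_pos: "0 \<le> \<epsilon> M"
      unfolding \<epsilon>_def using M c f_pos by (auto intro!: divide_nonneg_nonneg mult_nonneg_nonneg less_imp_le)
    have D_fin: "?D < \<infinity>"
      using d_pos by (intro mean_max_gamma_finite) auto
    then have D_eq: "?D = ennreal (D M)"
      by (simp add: D_def)
    have "0 < ?D"
      using d_pos m M by (intro mean_max_gamma_pos) auto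
    then have D_pos: "0 < D M"
      unfolding D_eq by simp
    have "?T \<le> ?D + ennreal (\<epsilon> M) * ?D"
      using \<open>?T \<le> ?D + ?B\<close> \<open>?B \<le> ennreal (\<epsilon> M) * ?D\<close> by (meson add_left_mono order.trans)
    also have "\<dots> = ennreal ((1 + \<epsilon> M) * D M)"
      using \<epsilon>_pos D_pos unfolding D_eq by (simp add: ennreal_mult[symmetric] algebra_simps)
    finally have T_le: "?T \<le> ennreal ((1 + \<epsilon> M) * D M)" .
    \<comment> \<open>Finiteness makes \<open>X M\<close> the true expectation rather than the
      default 0 that \<open>enn2real\<close> assigns to infinity.\<close>
    then have "?T < \<infinity>"
      by (rule le_less_trans) simp
    then obtain t where t: "?T = ennreal t" "0 \<le> t"
      by (cases ?T) auto
    have "t \<le> (1 + \<epsilon> M) * D M" "D M \<le> t"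
      using T_le \<open>?D \<le> ?T\<close> t \<epsilon>_pos D_pos unfolding D_eq by auto
    moreover have "X M = S M * t"
      unfolding X_def E using t S_pos by (simp add: ennreal_mult[symmetric])
    ultimately show "1 \<le> X M / (S M * D M)" "X M / (S M * D M) \<le> 1 + \<epsilon> M"
      using S_pos D_pos by (auto simp: field_simps)
  qed
  have "filterlim (\<lambda>M::nat. real (M div 2)) at_top sequentially"
    by (intro filterlim_compose[OF filterlim_real_sequentially] filterlim_at_top_div_const_nat) simp
  from filterlim_compose[OF assms(11) this]
  have "filterlim (\<lambda>M. c * f (real (M div 2))) at_top sequentially"
    using c(1) by (intro filterlim_tendsto_pos_mult_at_top[OF tendsto_const])
  then have "\<epsilon> \<longlonglongrightarrow> 0"
    unfolding \<epsilon>_def by (intro tendsto_divide_0[OF tendsto_const] filterlim_at_top_imp_at_infinity)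
  then have "(\<lambda>M. 1 + \<epsilon> M) \<longlonglongrightarrow> 1"
    using tendsto_add[OF tendsto_const, of \<epsilon> 0 sequentially 1] by simp
  with tendsto_const have "(\<lambda>M. X M / (S M * D M)) \<longlonglongrightarrow> 1"
  proof (rule tendsto_sandwich[rotated 2])
    show "eventually (\<lambda>M. 1 \<le> X M / (S M * D M)) sequentially"
      using bounds(1) by (rule eventually_sequentiallyI)
    show "eventually (\<lambda>M. X M / (S M * D M) \<le> 1 + \<epsilon> M) sequentially"
      using bounds(2) by (rule eventually_sequentiallyI)
  qed
  moreover have "(LINT u:{0..}|lborel. 1 - (\<Prod>j=1..M. 1 - exp_partial_sum m (d j * u) *
      exp (- (d j * u)))) = D M" for M
    unfolding D_def using d_pos by (intro set_integral_eq_mean_max_gamma) (auto intro: less_imp_le)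
  ultimately show ?thesis
    by (simp add: seq_asymp_def X_def S_def)
qed

end
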